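(* Let $\mathbb I\in\{\mathbb Z,\mathbb Q,\mathbb R\}$, let $\mathcal M^*$ be the set of closed $n\times n$ difference-bound matrices over $\overline{\mathbb I}$, and let $\mathcal M^*_\bot=\mathcal M^*\cup\{\bot^*\}$ with the structure and the meaning function $\gamma$ described in the context. Then: 1. $(\mathcal M^*_\bot,\sqsubseteq^*,\sqcap^*,\sqcup^*,\bot^*,\top^* )$ is a lattice (with least element $\bot^*$ and greatest element $\top^*$) and $\gamma$ is one-to-one. 2. If $(\mathbb I,\leq)$ is complete (i.e. $\mathbb I$ is $\mathbb Z$ or $\mathbb R$), this lattice is complete and $\gamma$ is meet-preserving: for every $X\subseteq\mathcal M^*_\bot$, $\gamma(\inf_{\sqsubseteq^*} X)=\bigcap\{\gamma(x)\;|\;x\in X\}$. Moreover, one then has a canonical Galois insertion between $(\mathcal P(\{v_2,\dots,v_n\}\to\mathbb I),\subseteq)$ and $(\mathcal M^*_\bot,\sqsubseteq^* )$, with concretization $\gamma$ and abstraction function $$\alpha(D)=\inf\nolimits_{\sqsubseteq^*}\{\vec m\in\mathcal M^*_\bot\;|\;D\subseteq\gamma(\vec m)\}.$$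
   Context: Let $\overline{\mathbb I}=\mathbb I\cup\{+\infty\}$ with the usual extended order, minimum, maximum and addition. Variables are $v_1,\dots,v_n$, with $v_1$ standing for the constant $0$. A difference-bound matrix (DBM) is an $n\times n$ matrix $\vec m$ with entries in $\overline{\mathbb I}$. Define $\mathcal D(\vec m)=\{(x_1,\dots,x_n)\in\mathbb I^n\;|\;\forall i,j,\ x_j-x_i\leq\vec m_{ij}\}$ and $\mathcal D^0(\vec m)=\{(x_2,\dots,x_n)\in\mathbb I^{n-1}\;|\;(0,x_2,\dots,x_n)\in\mathcal D(\vec m)\}$. Points of $\mathbb I^{n-1}$ are identified with maps $\{v_2,\dots,v_n\}\to\mathbb I$, and $\mathcal P(\cdot)$ denotes the power set. On DBMs: $\vec m\trianglelefteq\vec n$ iff $\vec m_{ij}\leq\vec n_{ij}$ for all $i,j$; $(\vec m\vee\vec n)_{ij}=\max(\vec m_{ij},\vec n_{ij})$; $(\vec m\wedge\vec n)_{ij}=\min(\vec m_{ij},\vec n_{ij})$. Closure: for a DBM $\vec m$ with $\mathcal D^0(\vec m)\neq\emptyset$, $\vec m^*_{ii}=0$, and for $i\neq j$, $\vec m^*_{ij}$ is the minimum of $\sum_{k=1}^{N-1}\vec m_{i_k i_{k+1}}$ over all finite sequences $i=i_1,\dots,i_N=j$ of indices. A DBM $\vec m$ is closed if $\mathcal D^0(\vec m)\neq\emptyset$ and $\vec m=\vec m^*$. Structure on $\mathcal M^*_\bot=\mathcal M^*\cup\{\bot^*\}$ ($\bot^*$ a new element): - $\top^*_{ij}=0$ if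 $i=j$, $+\infty$ otherwise. - $\vec m\sqsubseteq^*\vec n$ iff either $\vec m=\bot^*$, or $\vec m\neq\bot^*$, $\vec n\neq\bot^*$ and $\vec m\trianglelefteq\vec n$. - $\vec m\sqcup^*\vec n$ is $\vec m$ if $\vec n=\bot^*$, $\vec n$ if $\vec m=\bot^*$, and $\vec m\vee\vec n$ otherwise. - $\vec m\sqcap^*\vec n$ is $\bot^*$ if $\vec m=\bot^*$ or $\vec n=\bot^*$ or $\mathcal D^0(\vec m\wedge\vec n)=\emptyset$, and $(\vec m\wedge\vec n)^*$ otherwise. $\inf_{\sqsubseteq^*}$ denotes the greatest lower bound of an arbitrary subset for $\sqsubseteq^*$. Meaning function $\gamma:\mathcal M^*_\bot\to\mathcal P(\{v_2,\dots,v_n\}\to\mathbb I)$: $\gamma(\bot^* )=\emptyset$ and $\gamma(\vec m)=\mathcal D^0(\vec m)$ otherwise. "$(\mathbb I,\leq)$ complete" means that every non-empty subset of $\mathbb I$ bounded above has a least upper bound in $\mathbb I$. A Galois insertion $(\alpha,\gamma)$ is a Galois connection ($\alpha(D)\sqsubseteq^*\vec m\iff D\subseteq\gamma(\vec m)$) with $\alpha\circ\gamma=\mathrm{id}$. *)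

theory Defs
  imports Complex_Main "HOL-Library.Extended_Real" "HOL-Algebra.Galois_Connection"
begin

text \<open>
  The scalars form a subset \<open>I\<close> of the reals; \<open>\<int>\<close>, \<open>\<rat>\<close> and \<open>UNIV\<close> are the intended values.
  \<open>\<infinity>\<close> is the only infinite value admitted in \<open>ext_scalars I\<close>, so \<open>-\<infinity>\<close> is never a matrix entry.
  Matrices and points are extensional functions on \<open>{1..n}\<close> (respectively \<open>{2..n}\<close>), so that
  equality of functions is equality of matrices and points.
\<close>

definition ext_scalars :: "real set \<Rightarrow> ereal set" where
  "ext_scalars I = insert \<infinity> (ereal ` I)"

definition complete_scalars :: "real set \<Rightarrow> bool" where
  "complete_scalars I \<longleftrightarrow>
     (\<forall>S\<subseteq>I. S \<noteq> {} \<and> (\<exists>b\<in>I. \<forall>s\<in>S. s \<le> b) \<longrightarrow>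
        (\<exists>l\<in>I. (\<forall>s\<in>S. s \<le> l) \<and> (\<forall>b\<in>I. (\<forall>s\<in>S. s \<le> b) \<longrightarrow> l \<le> b)))"

type_synonym dbm = "nat \<Rightarrow> nat \<Rightarrow> ereal"

definition dbms :: "real set \<Rightarrow> nat \<Rightarrow> dbm set" where
  "dbms I n = {1..n} \<rightarrow>\<^sub>E {1..n} \<rightarrow>\<^sub>E ext_scalars I"

definition mk_dbm :: "nat \<Rightarrow> (nat \<Rightarrow> nat \<Rightarrow> ereal) \<Rightarrow> dbm" where
  "mk_dbm n f = (\<lambda>i\<in>{1..n}. \<lambda>j\<in>{1..n}. f i j)"

definition dbm_dom :: "real set \<Rightarrow> nat \<Rightarrow> dbm \<Rightarrow> (nat \<Rightarrow> real) set" where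
  "dbm_dom I n m =
     {x \<in> {1..n} \<rightarrow>\<^sub>E I. \<forall>i\<in>{1..n}. \<forall>j\<in>{1..n}. ereal (x j - x i) \<le> m i j}"

definition points :: "real set \<Rightarrow> nat \<Rightarrow> (nat \<Rightarrow> real) set" where
  "points I n = {2..n} \<rightarrow>\<^sub>E I"

definition dbm_dom0 :: "real set \<Rightarrow> nat \<Rightarrow> dbm \<Rightarrow> (nat \<Rightarrow> real) set" where
  "dbm_dom0 I n m = {x \<in> points I n. x(1 := 0) \<in> dbm_dom I n m}"

definition dbm_le :: "nat \<Rightarrow> dbm \<Rightarrow> dbm \<Rightarrow> bool" where
  "dbm_le n m m' \<longleftrightarrow> (\<forall>i\<in>{1..n}. \<forall>j\<in>{1..n}. m i j \<le> m' i j)"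

definition dbm_max :: "nat \<Rightarrow> dbm \<Rightarrow> dbm \<Rightarrow> dbm" where
  "dbm_max n m m' = mk_dbm n (\<lambda>i j. max (m i j) (m' i j))"

definition dbm_min :: "nat \<Rightarrow> dbm \<Rightarrow> dbm \<Rightarrow> dbm" where
  "dbm_min n m m' = mk_dbm n (\<lambda>i j. min (m i j) (m' i j))"

definition index_paths :: "nat \<Rightarrow> nat \<Rightarrow> nat \<Rightarrow> nat list set" where
  "index_paths n i j = {p. p \<noteq> [] \<and> set p \<subseteq> {1..n} \<and> hd p = i \<and> last p = j}"

definition path_weight :: "dbm \<Rightarrow> nat list \<Rightarrow> ereal" where
  "path_weight m p = (\<Sum>k<length p - 1. m (p ! k) (p ! Suc k))"

text \<open>
  \<open>LEAST\<close> denotes the minimum over the (infinite) set of paths. It is attained whenever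
  \<open>dbm_dom0 I n m\<close> is non-empty; the closure is only ever used in that case.
\<close>

definition dbm_closure :: "nat \<Rightarrow> dbm \<Rightarrow> dbm" where
  "dbm_closure n m =
     mk_dbm n (\<lambda>i j. if i = j then 0 else (LEAST w. w \<in> path_weight m ` index_paths n i j))"

definition closed_dbms :: "real set \<Rightarrow> nat \<Rightarrow> dbm set" where
  "closed_dbms I n = {m \<in> dbms I n. dbm_dom0 I n m \<noteq> {} \<and> m = dbm_closure n m}"

text \<open>The added least element is \<open>None\<close>.\<close>

fun cdbm_le :: "nat \<Rightarrow> dbm option \<Rightarrow> dbm option \<Rightarrow> bool" where
  "cdbm_le n None y \<longleftrightarrow> True"
| "cdbm_le n (Some m) None \<longleftrightarrow> False"
| "cdbm_le n (Some m) (Some m') \<longleftrightarrow> dbm_le n m m'"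

fun cdbm_join :: "nat \<Rightarrow> dbm option \<Rightarrow> dbm option \<Rightarrow> dbm option" where
  "cdbm_join n x None = x"
| "cdbm_join n None (Some m') = Some m'"
| "cdbm_join n (Some m) (Some m') = Some (dbm_max n m m')"

fun cdbm_meet :: "real set \<Rightarrow> nat \<Rightarrow> dbm option \<Rightarrow> dbm option \<Rightarrow> dbm option" where
  "cdbm_meet I n None y = None"
| "cdbm_meet I n (Some m) None = None"
| "cdbm_meet I n (Some m) (Some m') =
     (if dbm_dom0 I n (dbm_min n m m') = {} then None
      else Some (dbm_closure n (dbm_min n m m')))"

definition cdbm_bot :: "dbm option" where
  "cdbm_bot = None"

definition cdbm_top :: "nat \<Rightarrow> dbm option" where
  "cdbm_top n = Some (mk_dbm n (\<lambda>i j. if i = j then 0 else \<infinity>))"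

definition cdbm_order :: "real set \<Rightarrow> nat \<Rightarrow> dbm option gorder" where
  "cdbm_order I n =
     \<lparr>carrier = insert None (Some ` closed_dbms I n), eq = (=), le = cdbm_le n\<rparr>"

fun cdbm_gamma :: "real set \<Rightarrow> nat \<Rightarrow> dbm option \<Rightarrow> (nat \<Rightarrow> real) set" where
  "cdbm_gamma I n None = {}"
| "cdbm_gamma I n (Some m) = dbm_dom0 I n m"

definition cdbm_alpha :: "real set \<Rightarrow> nat \<Rightarrow> (nat \<Rightarrow> real) set \<Rightarrow> dbm option" where
  "cdbm_alpha I n D =
     \<Sqinter>\<^bsub>cdbm_order I n\<^esub> {x \<in> carrier (cdbm_order I n). D \<subseteq> cdbm_gamma I n x}"

definition powerset_order :: "'a set \<Rightarrow> 'a set gorder" where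
  "powerset_order A = \<lparr>carrier = Pow A, eq = (=), le = (\<subseteq>)\<rparr>"

definition galois_insertion :: "('a, 'b) galois \<Rightarrow> bool" where
  "galois_insertion G \<longleftrightarrow>
     galois_connection G \<and> (\<forall>y\<in>carrier (orderB G). lower G (upper G y) = y)"

end

theory Submission
  imports Defs "HOL-Analysis.Continuum_Not_Denumerable"
begin

text \<open>
  A matrix is closed iff it has zero diagonal and satisfies the triangle inequality. For such a
  matrix, a potential defined on some of the indices extends to one more index, hence to all of
  them. Starting from two indices, this shows that every finite entry of a closed matrix is
  attained by a point of its domain, so inclusion of domains is the entrywise order and
  \<open>\<gamma>\<close> is an order embedding. Infima are therefore the closed matrices whose domain is the
  intersection of the domains: for two matrices this is the shortest-path closure of the
  entrywise minimum, and for arbitrary families over complete scalars it is the matrix of suprema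
  of coordinate differences over the intersection.
\<close>

section \<open>Potentials\<close>

text \<open>This is the algebraic form of closedness, mentioning neither scalars nor paths;
  \<open>closed_dbms_iff\<close> proves the equivalence.\<close>

definition dbm_triangle :: "nat \<Rightarrow> dbm \<Rightarrow> bool" where
  "dbm_triangle n m \<longleftrightarrow> (\<forall>i\<in>{1..n}. m i i = 0) \<and>
     (\<forall>i\<in>{1..n}. \<forall>j\<in>{1..n}. \<forall>k\<in>{1..n}. m i j \<le> m i k + m k j)"

text \<open>A point of the domain known only on the indices \<open>S\<close>, without extensionality
  and without fixing coordinate 1, so that points can be built one index at a time.\<close>

definition potential_on :: "real set \<Rightarrow> nat set \<Rightarrow> dbm \<Rightarrow> (nat \<Rightarrow> real) \<Rightarrow> bool" where
  "potential_on I S m x \<longleftrightarrow>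
     (\<forall>s\<in>S. x s \<in> I) \<and> (\<forall>s\<in>S. \<forall>t\<in>S. ereal (x t - x s) \<le> m s t)"

text \<open>A common setting for the three cases: \<open>I\<close> is an additive subgroup of the
  reals containing 1, hence unbounded.\<close>

locale dbm_space =
  fixes I :: "real set" and n :: nat
  assumes zero_scalar: "0 \<in> I"
    and one_scalar: "1 \<in> I"
    and diff_scalar: "a \<in> I \<Longrightarrow> b \<in> I \<Longrightarrow> a - b \<in> I"
    and dim_pos: "n \<ge> 1"
begin

section \<open>Arithmetic of scalars and matrix entries\<close>

lemma uminus_scalar: "a \<in> I \<Longrightarrow> - a \<in> I"
  using diff_scalar[OF zero_scalar, of a] by simp

lemma add_scalar: "a \<in> I \<Longrightarrow> b \<in> I \<Longrightarrow> a + b \<in> I"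
  using diff_scalar[of a "- b"] uminus_scalar by simp

lemma scalars_unbounded: "\<exists>r\<in>I. c \<le> r"
proof -
  have "real k \<in> I" for k
    by (induction k) (auto simp: zero_scalar one_scalar add_scalar)
  then show ?thesis
    using real_arch_simple by blast
qed

lemma ext_scalars_add: "a \<in> ext_scalars I \<Longrightarrow> b \<in> ext_scalars I \<Longrightarrow> a + b \<in> ext_scalars I"
  by (auto simp: ext_scalars_def add_scalar)

lemma zero_ext_scalar: "0 \<in> ext_scalars I"
  using zero_scalar by (auto simp: ext_scalars_def zero_ereal_def)

lemma dbms_entry: "m \<in> dbms I n \<Longrightarrow> i \<in> {1..n} \<Longrightarrow> j \<in> {1..n} \<Longrightarrow> m i j \<in> ext_scalars I"
  unfolding dbms_def by (meson PiE_mem)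

lemma dbms_entry_cases:
  assumes "m \<in> dbms I n" "i \<in> {1..n}" "j \<in> {1..n}"
  obtains "m i j = \<infinity>" | r where "r \<in> I" "m i j = ereal r"
  using dbms_entry[OF assms] by (auto simp: ext_scalars_def)

lemma dbms_eqI:
  assumes "m \<in> dbms I n" "m' \<in> dbms I n"
    and "\<And>i j. i \<in> {1..n} \<Longrightarrow> j \<in> {1..n} \<Longrightarrow> m i j = m' i j"
  shows "m = m'"
proof (rule PiE_ext)
  show "m \<in> {1..n} \<rightarrow>\<^sub>E {1..n} \<rightarrow>\<^sub>E ext_scalars I" "m' \<in> {1..n} \<rightarrow>\<^sub>E {1..n} \<rightarrow>\<^sub>E ext_scalars I"
    using assms by (auto simp: dbms_def)
  show "m i = m' i" if "i \<in> {1..n}" for i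
    by (rule PiE_ext[where k = "{1..n}" and s = "\<lambda>_. ext_scalars I"])
       (use assms that in \<open>auto simp: dbms_def PiE_iff\<close>)
qed

lemma mk_dbm_apply [simp]: "i \<in> {1..n} \<Longrightarrow> j \<in> {1..n} \<Longrightarrow> mk_dbm n f i j = f i j"
  by (simp add: mk_dbm_def)

lemma mk_dbm_in_dbms:
  "(\<And>i j. i \<in> {1..n} \<Longrightarrow> j \<in> {1..n} \<Longrightarrow> f i j \<in> ext_scalars I) \<Longrightarrow> mk_dbm n f \<in> dbms I n"
  by (auto simp: mk_dbm_def dbms_def)

text \<open>
  The new value has to lie between the lower bounds \<open>x t - m k t\<close> and the upper bounds
  \<open>x s + m s k\<close>; the triangle inequality makes every lower bound at most every upper bound.
\<close>

lemma potential_on_insert: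
  assumes m: "m \<in> dbms I n" and tri: "dbm_triangle n m"
    and S: "insert k S \<subseteq> {1..n}" "k \<notin> S"
    and pot: "potential_on I S m x"
  shows "\<exists>v. potential_on I (insert k S) m (x(k := v))"
proof -
  have fin: "finite S"
    using S by (meson finite_atLeastAtMost finite_subset insert_subset)
  define A where "A = {s \<in> S. m s k \<noteq> \<infinity>}"
  define B where "B = {s \<in> S. m k s \<noteq> \<infinity>}"
  define u where "u s = x s + real_of_ereal (m s k)" for s
  define l where "l s = x s - real_of_ereal (m k s)" for s
  have sub: "s \<in> {1..n}" if "s \<in> S" for s
    using S that by blast
  have A: "\<exists>r\<in>I. m s k = ereal r" if "s \<in> A" for s
    using dbms_entry[OF m, of s k] sub[of s] that S by (auto simp: A_def ext_scalars_def)
  have B: "\<exists>r\<in>I. m k s = ereal r" if "s \<in> B" for s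
    using dbms_entry[OF m, of k s] sub[of s] that S by (auto simp: B_def ext_scalars_def)
  have lu: "l t \<le> u s" if st: "s \<in> A" "t \<in> B" for s t
  proof -
    obtain a b where ab: "m s k = ereal a" "m k t = ereal b"
      using A[OF st(1)] B[OF st(2)] by blast
    have "ereal (x t - x s) \<le> m s t"
      using pot that by (auto simp: potential_on_def A_def B_def)
    also have "\<dots> \<le> m s k + m k t"
      using tri that S unfolding dbm_triangle_def A_def B_def by blast
    finally show ?thesis
      using ab by (simp add: u_def l_def)
  qed
  have x: "x s \<in> I" if "s \<in> S" for s
    using pot that by (auto simp: potential_on_def)
  have uI: "u s \<in> I" if "s \<in> A" for s
    using A[OF that] x[of s] that by (auto simp: u_def A_def add_scalar)
  have lI: "l s \<in> I" if "s \<in> B" for s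
    using B[OF that] x[of s] that by (auto simp: l_def B_def diff_scalar)
  have finAB: "finite A" "finite B"
    using fin by (auto simp: A_def B_def)
  \<comment> \<open>The tightest bound is taken: the least upper bound if there is one, else the
    greatest lower bound or 0. As one of finitely many elements of \<open>I\<close>, it lies in
    \<open>I\<close> even for the rationals.\<close>
  define v where "v = (if A = {} then Max (insert 0 (l ` B)) else Min (u ` A))"
  have v: "v \<in> I \<and> (\<forall>s\<in>A. v \<le> u s) \<and> (\<forall>t\<in>B. l t \<le> v)"
  proof (cases "A = {}")
    case True
    have "Max (insert 0 (l ` B)) \<in> insert 0 (l ` B)"
      using finAB by (intro Max_in) auto
    then show ?thesis
      using True lI zero_scalar finAB by (auto simp: v_def simp del: Max_insert)
  next
    case False
    have "Min (u ` A) \<in> u ` A"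
      using finAB False by (intro Min_in) auto
    then have "Min (u ` A) \<in> I"
      using uI by (metis imageE)
    then show ?thesis
      using False finAB lu by (simp add: v_def)
  qed
  have up: "ereal (v - x s) \<le> m s k" if "s \<in> S" for s
  proof (cases "m s k = \<infinity>")
    case False
    with that have "s \<in> A" by (simp add: A_def)
    with A[of s] v show ?thesis by (fastforce simp: u_def)
  qed simp
  have lo: "ereal (x s - v) \<le> m k s" if "s \<in> S" for s
  proof (cases "m k s = \<infinity>")
    case False
    with that have "s \<in> B" by (simp add: B_def)
    with B[of s] v show ?thesis by (fastforce simp: l_def)
  qed simp
  have "m k k = 0"
    using tri S by (auto simp: dbm_triangle_def)
  then have "potential_on I (insert k S) m (x(k := v))"
    using pot v up lo S by (auto simp: potential_on_def)
  then show ?thesis ..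
qed

lemma potential_on_extend:
  assumes m: "m \<in> dbms I n" and tri: "dbm_triangle n m"
    and S: "S \<subseteq> {1..n}" and pot: "potential_on I S m x"
  shows "\<exists>y. potential_on I {1..n} m y \<and> (\<forall>s\<in>S. y s = x s)"
proof -
  \<comment> \<open>Stated for a finite set \<open>T\<close> of added indices, so that induction
    adds one at a time while the values on \<open>S\<close> stay fixed.\<close>
  have "\<exists>y. potential_on I (S \<union> T) m y \<and> (\<forall>s\<in>S. y s = x s)" if "finite T" "T \<subseteq> {1..n}" for T
    using that
  proof (induction T)
    case empty
    then show ?case using pot by auto
  next
    case (insert k T)
    then obtain y where y: "potential_on I (S \<union> T) m y" "\<forall>s\<in>S. y s = x s"
      by auto
    show ?case
    proof (cases "k \<in> S")
      case True
      then show ?thesis using y by (auto simp: insert_absorb)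
    next
      case False
      have "insert k (S \<union> T) \<subseteq> {1..n}" "k \<notin> S \<union> T"
        using insert False S by auto
      from potential_on_insert[OF m tri this y(1)] obtain v
        where "potential_on I (insert k (S \<union> T)) m (y(k := v))" ..
      then show ?thesis
        using y(2) False by (metis Un_insert_right fun_upd_other)
    qed
  qed
  from this[of "{1..n}"] S show ?thesis
    by (simp add: Un_absorb1)
qed

text \<open>Membership in the domain becomes a family of inequalities on \<open>x(1 := 0)\<close>;
  later proofs work through this form.\<close>

lemma dom0_iff:
  "x \<in> dbm_dom0 I n m \<longleftrightarrow> x \<in> points I n \<and> potential_on I {1..n} m (x(1 := 0))"
proof -
  have "x(1 := 0) \<in> {1..n} \<rightarrow>\<^sub>E I" if "x \<in> points I n"
  proof -
    have "{1..n} = insert 1 {2..n}" using dim_pos by auto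
    then show ?thesis
      using that zero_scalar by (auto simp: points_def PiE_iff extensional_def)
  qed
  then have "x \<in> points I n \<Longrightarrow> x(1 := 0) \<in> {1..n} \<rightarrow>\<^sub>E I \<and> (\<forall>s\<in>{1..n}. (x(1 := 0)) s \<in> I)"
    by (meson PiE_mem)
  then show ?thesis
    unfolding dbm_dom0_def dbm_dom_def potential_on_def by blast
qed

text \<open>The constraints see only differences, so subtracting \<open>y 1\<close> everywhere moves
  coordinate 1 to 0.\<close>

lemma potential_imp_dom0:
  assumes "potential_on I {1..n} m y"
  shows "\<exists>x\<in>dbm_dom0 I n m. \<forall>i\<in>{1..n}. (x(1 := 0)) i = y i - y 1"
proof -
  define x where "x = restrict (\<lambda>i. y i - y 1) {2..n}"
  have val: "(x(1 := 0)) i = y i - y 1" if "i \<in> {1..n}" for i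
    using that by (auto simp: x_def)
  have "1 \<in> {1..n}" using dim_pos by simp
  then have "x \<in> points I n"
    using assms by (auto simp: x_def points_def potential_on_def diff_scalar)
  moreover have "potential_on I {1..n} m (x(1 := 0))"
    unfolding potential_on_def
  proof (intro conjI ballI)
    fix s assume "s \<in> {1..n}"
    then show "(x(1 := 0)) s \<in> I"
      using assms \<open>1 \<in> {1..n}\<close> unfolding val[OF \<open>s \<in> {1..n}\<close>]
      by (auto simp: potential_on_def intro!: diff_scalar)
  next
    fix s t assume st: "s \<in> {1..n}" "t \<in> {1..n}"
    show "ereal ((x(1 := 0)) t - (x(1 := 0)) s) \<le> m s t"
      using assms st unfolding val[OF st(1)] val[OF st(2)] by (auto simp: potential_on_def)
  qed
  ultimately have "x \<in> dbm_dom0 I n m" by (simp add: dom0_iff)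
  then show ?thesis using val by blast
qed

lemma triangle_dom0_nonempty:
  assumes "m \<in> dbms I n" "dbm_triangle n m"
  shows "dbm_dom0 I n m \<noteq> {}"
proof -
  have "potential_on I {} m (\<lambda>_. 0)" by (simp add: potential_on_def)
  from potential_on_extend[OF assms _ this] obtain y where "potential_on I {1..n} m y"
    by auto
  then show ?thesis
    using potential_imp_dom0 by blast
qed

text \<open>The values 0 at \<open>i\<close> and \<open>r\<close> at \<open>j\<close> form a
  potential on two indices, since the bounds on \<open>r\<close> are the only off-diagonal
  constraints there. Extending it and normalising keeps the difference.\<close>

lemma triangle_attained:
  assumes m: "m \<in> dbms I n" and tri: "dbm_triangle n m"
    and ij: "i \<in> {1..n}" "j \<in> {1..n}" "i \<noteq> j"
    and r: "r \<in> I" "ereal r \<le> m i j" "ereal (- r) \<le> m j i"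
  obtains x where "x \<in> dbm_dom0 I n m" "(x(1 := 0)) j - (x(1 := 0)) i = r"
proof -
  have "m i i = 0" "m j j = 0"
    using tri ij by (auto simp: dbm_triangle_def)
  then have "potential_on I {i, j} m ((\<lambda>_. 0)(j := r))"
    using r ij zero_scalar by (auto simp: potential_on_def)
  from potential_on_extend[OF m tri _ this] ij obtain y
    where y: "potential_on I {1..n} m y" "y i = 0" "y j = r"
    by (auto simp del: fun_upd_apply)
       (metis fun_upd_other fun_upd_same)
  from y(1) obtain x where dom0: "x \<in> dbm_dom0 I n m"
    and x: "\<forall>i\<in>{1..n}. (x(1 := 0)) i = y i - y 1"
    using potential_imp_dom0 by blast
  have "(x(1 := 0)) j - (x(1 := 0)) i = r"
    using bspec[OF x ij(1)] bspec[OF x ij(2)] y by simp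
  with dom0 show ?thesis
    by (rule that)
qed

lemma dom0_mono: "dbm_le n m m' \<Longrightarrow> dbm_dom0 I n m \<subseteq> dbm_dom0 I n m'"
  by (auto simp: dom0_iff potential_on_def dbm_le_def simp del: fun_upd_apply)
     (meson order_trans atLeastAtMost_iff)

text \<open>Each entry of \<open>m\<close> is attained as a difference of coordinates (approached, if infinite).\<close>

lemma dom0_subset_imp_le:
  assumes m: "m \<in> dbms I n" "dbm_triangle n m"
    and m': "m' \<in> dbms I n" "dbm_triangle n m'"
    and sub: "dbm_dom0 I n m \<subseteq> dbm_dom0 I n m'"
  shows "dbm_le n m m'"
  unfolding dbm_le_def
proof (intro ballI)
  fix i j assume ij: "i \<in> {1..n}" "j \<in> {1..n}"
  have bound: "ereal r \<le> m' i j"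
    if h: "i \<noteq> j" "r \<in> I" "ereal r \<le> m i j" "ereal (- r) \<le> m j i" for r
  proof -
    obtain x where x: "x \<in> dbm_dom0 I n m" "(x(1 := 0)) j - (x(1 := 0)) i = r"
      by (rule triangle_attained[OF m ij h])
    then have "x \<in> dbm_dom0 I n m'" using sub by blast
    then have "ereal ((x(1 := 0)) j - (x(1 := 0)) i) \<le> m' i j"
      using ij unfolding dom0_iff potential_on_def by blast
    then show ?thesis using x(2) by simp
  qed
  show "m i j \<le> m' i j"
  proof (cases "i = j")
    case True
    then show ?thesis using m m' ij by (auto simp: dbm_triangle_def)
  next
    case False
    \<comment> \<open>For a finite entry this gives \<open>- m i j \<le> m j i\<close>, so the entry
      itself is an admissible \<open>r\<close> in \<open>bound\<close>.\<close>
    have cycle: "0 \<le> m i j + m j i"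
      using m(2) ij unfolding dbm_triangle_def by metis
    show ?thesis
    proof (cases rule: dbms_entry_cases[OF m(1) ij])
      case 1
      show ?thesis
      proof (rule ccontr)
        assume "\<not> ?thesis"
        then obtain c where c: "m' i j = ereal c"
          using dbms_entry[OF m'(1) ij] 1 by (auto simp: ext_scalars_def)
        \<comment> \<open>With \<open>m i j\<close> infinite and \<open>m' i j\<close> a real
          \<open>c\<close>, a scalar \<open>r\<close> above both \<open>c + 1\<close> and
          \<open>b\<close> respects the opposite constraint and contradicts
          \<open>bound\<close>.\<close>
        obtain b where b: "ereal (- b) \<le> m j i"
          by (cases rule: dbms_entry_cases[OF m(1) ij(2,1)]) (metis ereal_less_eq(1), metis add.inverse_inverse order_refl)
        obtain r where r: "r \<in> I" "max (c + 1) b \<le> r"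
          using scalars_unbounded by blast
        have "ereal (- r) \<le> ereal (- b)" using r by simp
        then have "ereal (- r) \<le> m j i" using b by (rule order_trans)
        then have "ereal r \<le> m' i j"
          using bound[OF False r(1)] 1 by simp
        then show False using c r by simp
      qed
    next
      case (2 r)
      then show ?thesis
        using bound[OF False 2(1)] cycle by (cases "m j i") auto
    qed
  qed
qed

section \<open>Shortest paths\<close>

lemma path_weight_Nil [simp]: "path_weight m [] = 0"
  and path_weight_single [simp]: "path_weight m [a] = 0"
  by (simp_all add: path_weight_def)

lemma path_weight_Cons2 [simp]: "path_weight m (a # b # p) = m a b + path_weight m (b # p)"
  by (simp add: path_weight_def sum.lessThan_Suc_shift del: sum.lessThan_Suc)

text \<open>Weights sit on edges, so the junction \<open>a\<close> ends the first piece and starts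
  the second.\<close>

lemma path_weight_append:
  "path_weight m (p @ a # q) = path_weight m (p @ [a]) + path_weight m (a # q)"
proof (induction p rule: induct_list012)
  case (2 b)
  show ?case by simp
qed (simp_all add: add.assoc)

text \<open>The differences along the path telescope. On a cycle the left side is 0, so the
  existence of a potential excludes negative cycles.\<close>

lemma path_weight_ge:
  assumes "potential_on I {1..n} m x" "p \<noteq> []" "set p \<subseteq> {1..n}"
  shows "ereal (x (last p) - x (hd p)) \<le> path_weight m p"
  using assms(2,3)
proof (induction p rule: induct_list012)
  case (3 a b p)
  then have "ereal (x b - x a) \<le> m a b"
    using assms(1) by (auto simp: potential_on_def)
  moreover have "ereal (x (last (b # p)) - x b) \<le> path_weight m (b # p)"
    using 3 by simp
  ultimately have "ereal (x b - x a) + ereal (x (last (b # p)) - x b) \<le> path_weight m (a # b # p)"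
    by (simp only: path_weight_Cons2 add_mono)
  then show ?case by simp
qed (simp_all add: zero_ereal_def)

lemma path_weight_ext_scalar:
  assumes "m \<in> dbms I n" "set p \<subseteq> {1..n}"
  shows "path_weight m p \<in> ext_scalars I"
  using assms(2)
  by (induction p rule: induct_list012)
     (auto simp: zero_ext_scalar intro!: ext_scalars_add dbms_entry[OF assms(1)])

text \<open>Cutting out the cycle between two visits to the same index cannot increase the weight,
  as cycles are non-negative; repeat until nothing repeats.\<close>

lemma distinct_path_le:
  assumes pot: "potential_on I {1..n} m x" and p: "p \<in> index_paths n i j"
  shows "\<exists>q\<in>index_paths n i j. distinct q \<and> path_weight m q \<le> path_weight m p"
  using p
proof (induction "length p" arbitrary: p rule: less_induct)
  case less
  show ?case
  proof (cases "distinct p")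
    case False
    then obtain as bs cs a where eq: "p = as @ [a] @ bs @ [a] @ cs"
      using not_distinct_decomp by blast
    have p: "p \<noteq> []" "set p \<subseteq> {1..n}" "hd p = i" "last p = j"
      using less.prems by (auto simp: index_paths_def)
    define q where "q = as @ a # cs"
    have q: "q \<in> index_paths n i j" "length q < length p"
      using p unfolding index_paths_def q_def eq
      by (auto simp: hd_append)
    have "0 \<le> path_weight m (a # bs @ [a])"
      using path_weight_ge[OF pot, of "a # bs @ [a]"] p(2) by (auto simp: eq zero_ereal_def)
    then have "path_weight m (a # cs) \<le> path_weight m (a # bs @ [a]) + path_weight m (a # cs)"
      by (simp add: add_increasing)
    also have "\<dots> = path_weight m (a # bs @ a # cs)"
      using path_weight_append[of m "a # bs" a cs] by simp
    finally have "path_weight m q \<le> path_weight m p"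
      using path_weight_append[of m as a cs] path_weight_append[of m as a "bs @ a # cs"]
      by (simp add: q_def eq add_left_mono)
    moreover obtain q' where "q' \<in> index_paths n i j" "distinct q'"
      "path_weight m q' \<le> path_weight m q"
      using less.hyps[OF q(2,1)] by blast
    ultimately show ?thesis
      using order_trans by blast
  qed (use less.prems in blast)
qed

text \<open>Only finitely many paths are repetition-free, and \<open>distinct_path_le\<close>
  reduces to these, so the \<open>LEAST\<close> in the closure is attained.\<close>

lemma closure_shortest_path:
  assumes pot: "potential_on I {1..n} m x" and ij: "i \<in> {1..n}" "j \<in> {1..n}"
  shows "\<exists>p\<in>index_paths n i j. dbm_closure n m i j = path_weight m p \<and>
           (\<forall>q\<in>index_paths n i j. path_weight m p \<le> path_weight m q)"
proof (cases "i = j")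
  case True
  \<comment> \<open>The diagonal value 0 set by the closure is the weight of the one-vertex path,
    minimal because every cycle is non-negative.\<close>
  have "[i] \<in> index_paths n i j" using True ij by (simp add: index_paths_def)
  moreover have "0 \<le> path_weight m q" if "q \<in> index_paths n i j" for q
    using path_weight_ge[OF pot, of q] that True by (auto simp: index_paths_def zero_ereal_def)
  moreover have "dbm_closure n m i j = path_weight m [i]"
    using ij True by (simp add: dbm_closure_def)
  ultimately show ?thesis by (metis path_weight_single)
next
  case False
  let ?Q = "{q \<in> index_paths n i j. distinct q}"
  have "?Q \<subseteq> {q. set q \<subseteq> {1..n} \<and> distinct q}"
    by (auto simp: index_paths_def)
  then have fin: "finite ?Q"
    by (rule finite_subset) (rule finite_subset_distinct, simp)
  have ne: "[i, j] \<in> ?Q"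
    using ij False by (simp add: index_paths_def)
  obtain p where p: "p \<in> ?Q" "\<And>q. q \<in> ?Q \<Longrightarrow> path_weight m p \<le> path_weight m q"
  proof
    show "arg_min_on (path_weight m) ?Q \<in> ?Q"
      using fin ne by (intro arg_min_if_finite(1)) auto
    show "path_weight m (arg_min_on (path_weight m) ?Q) \<le> path_weight m q" if "q \<in> ?Q" for q
      using fin ne that by (intro arg_min_least) auto
  qed
  have min: "path_weight m p \<le> path_weight m q" if "q \<in> index_paths n i j" for q
    using distinct_path_le[OF pot that] p(2) order_trans by blast
  have "(LEAST w. w \<in> path_weight m ` index_paths n i j) = path_weight m p"
    using p(1) min by (intro Least_equality) auto
  then show ?thesis
    using p(1) min ij False by (auto simp: dbm_closure_def)
qed

lemma closure_in_dbms:
  assumes m: "m \<in> dbms I n" and pot: "potential_on I {1..n} m x"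
  shows "dbm_closure n m \<in> dbms I n"
proof -
  have "dbm_closure n m i j \<in> ext_scalars I" if ij: "i \<in> {1..n}" "j \<in> {1..n}" for i j
    using closure_shortest_path[OF pot ij] path_weight_ext_scalar[OF m]
    by (auto simp: index_paths_def)
  then show ?thesis
    unfolding dbm_closure_def by (intro mk_dbm_in_dbms) simp
qed

text \<open>Joining shortest paths from \<open>i\<close> to \<open>k\<close> and from
  \<open>k\<close> to \<open>j\<close> at \<open>k\<close> gives a competitor for the shortest path
  from \<open>i\<close> to \<open>j\<close>.\<close>

lemma closure_triangle:
  assumes pot: "potential_on I {1..n} m x"
  shows "dbm_triangle n (dbm_closure n m)"
  unfolding dbm_triangle_def
proof (intro conjI ballI)
  fix i j k assume ijk: "i \<in> {1..n}" "j \<in> {1..n}" "k \<in> {1..n}"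
  obtain p where p: "p \<in> index_paths n i k" "dbm_closure n m i k = path_weight m p"
    using closure_shortest_path[OF pot ijk(1,3)] by blast
  obtain q where q: "q \<in> index_paths n k j" "dbm_closure n m k j = path_weight m q"
    using closure_shortest_path[OF pot ijk(3,2)] by blast
  obtain p' where p': "p = p' @ [k]"
    using p(1) by (auto simp: index_paths_def) (metis append_butlast_last_id)
  obtain q' where q': "q = k # q'"
    using q(1) by (cases q) (auto simp: index_paths_def)
  have "p' @ k # q' \<in> index_paths n i j"
    using p(1) q(1) by (cases p') (auto simp: index_paths_def p' q')
  then have "dbm_closure n m i j \<le> path_weight m (p' @ k # q')"
    using closure_shortest_path[OF pot ijk(1,2)] by auto
  then show "dbm_closure n m i j \<le> dbm_closure n m i k + dbm_closure n m k j"
    using p(2) q(2) p' q' path_weight_append[of m p' k q'] by simp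
qed (simp add: dbm_closure_def)

text \<open>A single edge is a path, so the closure lies below \<open>m\<close>; conversely
  \<open>path_weight_ge\<close> makes every potential respect the shortest paths.\<close>

lemma closure_dom0:
  assumes pot: "potential_on I {1..n} m x"
  shows "dbm_dom0 I n (dbm_closure n m) = dbm_dom0 I n m"
proof
  have "dbm_closure n m i j \<le> m i j" if ij: "i \<in> {1..n}" "j \<in> {1..n}" for i j
  proof -
    have "[i, j] \<in> index_paths n i j" using ij by (simp add: index_paths_def)
    then have "dbm_closure n m i j \<le> path_weight m [i, j]"
      using closure_shortest_path[OF pot ij] by auto
    then show ?thesis by simp
  qed
  then show "dbm_dom0 I n (dbm_closure n m) \<subseteq> dbm_dom0 I n m"
    by (intro dom0_mono) (simp add: dbm_le_def)
  have "ereal (y j - y i) \<le> dbm_closure n m i j"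
    if y: "potential_on I {1..n} m y" and ij: "i \<in> {1..n}" "j \<in> {1..n}" for y i j
    using closure_shortest_path[OF pot ij] path_weight_ge[OF y]
    by (auto simp: index_paths_def)
  then show "dbm_dom0 I n m \<subseteq> dbm_dom0 I n (dbm_closure n m)"
    unfolding subset_iff dom0_iff potential_on_def by (simp del: fun_upd_apply)
qed

text \<open>Under the triangle inequality the direct edge is a shortest path, so closure leaves such
  a matrix unchanged.\<close>

lemma triangle_path_weight:
  assumes "dbm_triangle n m" "p \<noteq> []" "set p \<subseteq> {1..n}"
  shows "m (hd p) (last p) \<le> path_weight m p"
  using assms(2,3)
proof (induction p rule: induct_list012)
  case (2 a)
  then show ?case using assms(1) by (simp add: dbm_triangle_def)
next
  case (3 a b p)
  let ?c = "last (b # p)"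
  have "?c \<in> {1..n}"
    using 3 by (meson last_in_set list.discI set_subset_Cons subset_iff)
  then have "m a ?c \<le> m a b + m b ?c"
    using 3 assms(1) unfolding dbm_triangle_def by auto
  also have "\<dots> \<le> m a b + path_weight m (b # p)"
    using 3 by (intro add_left_mono) simp
  finally show ?case by simp
qed simp

text \<open>Replaces the fixpoint equation and the non-emptiness condition by entrywise conditions:
  non-emptiness comes from extending the empty potential, the fixpoint from
  \<open>triangle_path_weight\<close>.\<close>

lemma closed_dbms_iff: "m \<in> closed_dbms I n \<longleftrightarrow> m \<in> dbms I n \<and> dbm_triangle n m"
proof
  assume "m \<in> closed_dbms I n"
  then obtain x where "m \<in> dbms I n" "potential_on I {1..n} m (x(1 := 0))" "m = dbm_closure n m"
    by (auto simp: closed_dbms_def dom0_iff simp del: fun_upd_apply)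
  then show "m \<in> dbms I n \<and> dbm_triangle n m"
    using closure_triangle by metis
next
  assume m: "m \<in> dbms I n \<and> dbm_triangle n m"
  then obtain x where pot: "potential_on I {1..n} m (x(1 := 0))" and ne: "dbm_dom0 I n m \<noteq> {}"
    using triangle_dom0_nonempty by (fastforce simp: dom0_iff simp del: fun_upd_apply)
  have "m = dbm_closure n m"
  proof (rule dbms_eqI)
    fix i j assume ij: "i \<in> {1..n}" "j \<in> {1..n}"
    obtain p where p: "p \<in> index_paths n i j" "dbm_closure n m i j = path_weight m p"
      and min: "\<forall>q\<in>index_paths n i j. path_weight m p \<le> path_weight m q"
      using closure_shortest_path[OF pot ij] by blast
    have "[i, j] \<in> index_paths n i j" using ij by (simp add: index_paths_def)
    with min have "path_weight m p \<le> m i j" by fastforce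
    moreover have "m i j \<le> path_weight m p"
      using triangle_path_weight[of m p] m p(1) by (auto simp: index_paths_def)
    ultimately show "m i j = dbm_closure n m i j" using p(2) by simp
  qed (use m closure_in_dbms[OF _ pot] in auto)
  then show "m \<in> closed_dbms I n"
    using m ne by (simp add: closed_dbms_def)
qed

lemma closure_closed:
  assumes "m \<in> dbms I n" "dbm_dom0 I n m \<noteq> {}"
  shows "dbm_closure n m \<in> closed_dbms I n"
    and "dbm_dom0 I n (dbm_closure n m) = dbm_dom0 I n m"
proof -
  obtain x where pot: "potential_on I {1..n} m (x(1 := 0))"
    using assms(2) by (auto simp: dom0_iff simp del: fun_upd_apply)
  show "dbm_closure n m \<in> closed_dbms I n"
    using closure_in_dbms[OF assms(1) pot] closure_triangle[OF pot] by (simp add: closed_dbms_iff)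
  show "dbm_dom0 I n (dbm_closure n m) = dbm_dom0 I n m"
    by (rule closure_dom0[OF pot])
qed

section \<open>The lattice of closed matrices\<close>

abbreviation "L \<equiv> cdbm_order I n"
abbreviation "\<gamma> \<equiv> cdbm_gamma I n"

lemma carrier_cases:
  assumes "x \<in> carrier L"
  obtains "x = None" | m where "x = Some m" "m \<in> closed_dbms I n"
  using assms by (auto simp: cdbm_order_def)

lemma None_carrier [simp]: "None \<in> carrier L"
  and Some_carrier [simp]: "Some m \<in> carrier L \<longleftrightarrow> m \<in> closed_dbms I n"
  by (auto simp: cdbm_order_def)

text \<open>For matrices this combines \<open>dom0_mono\<close> and
  \<open>dom0_subset_imp_le\<close>; non-emptiness of closed domains keeps matrices from lying below
  \<open>None\<close>.\<close>

lemma cdbm_le_iff_gamma: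
  assumes "x \<in> carrier L" "y \<in> carrier L"
  shows "x \<sqsubseteq>\<^bsub>L\<^esub> y \<longleftrightarrow> \<gamma> x \<subseteq> \<gamma> y"
proof -
  have "dbm_le n m m' \<longleftrightarrow> dbm_dom0 I n m \<subseteq> dbm_dom0 I n m'"
    if "m \<in> closed_dbms I n" "m' \<in> closed_dbms I n" for m m'
    using that dom0_mono dom0_subset_imp_le by (auto simp: closed_dbms_iff)
  moreover have "dbm_dom0 I n m \<noteq> {}" if "m \<in> closed_dbms I n" for m
    using that by (simp add: closed_dbms_def)
  ultimately show ?thesis
    using assms by (auto simp: cdbm_order_def)
qed

lemma gamma_inj: "inj_on \<gamma> (carrier L)"
proof (rule inj_onI)
  fix x y assume xy: "x \<in> carrier L" "y \<in> carrier L" "\<gamma> x = \<gamma> y"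
  then have le: "cdbm_le n x y" "cdbm_le n y x"
    using cdbm_le_iff_gamma[of x y] cdbm_le_iff_gamma[of y x] by (auto simp: cdbm_order_def)
  show "x = y"
  proof (cases rule: carrier_cases[OF xy(1)]; cases rule: carrier_cases[OF xy(2)])
    fix m m' assume m: "x = Some m" "m \<in> closed_dbms I n" "y = Some m'" "m' \<in> closed_dbms I n"
    with le have "m = m'"
      by (intro dbms_eqI) (auto simp: closed_dbms_iff dbm_le_def intro: antisym)
    with m show ?thesis by simp
  qed (use le in auto)
qed

lemma partial_order_cdbm: "partial_order L"
proof unfold_locales
  show "(.=\<^bsub>L\<^esub>) = (=)" by (simp add: cdbm_order_def)
next
  fix x y assume "x \<sqsubseteq>\<^bsub>L\<^esub> y" "y \<sqsubseteq>\<^bsub>L\<^esub> x" "x \<in> carrier L" "y \<in> carrier L"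
  then have "x = y"
    using cdbm_le_iff_gamma[of x y] cdbm_le_iff_gamma[of y x] inj_onD[OF gamma_inj]
    by (metis subset_antisym)
  then show "x .=\<^bsub>L\<^esub> y" by (simp add: cdbm_order_def)
next
  fix x y z assume "x \<sqsubseteq>\<^bsub>L\<^esub> y" "y \<sqsubseteq>\<^bsub>L\<^esub> z" "x \<in> carrier L" "y \<in> carrier L" "z \<in> carrier L"
  then show "x \<sqsubseteq>\<^bsub>L\<^esub> z" by (auto simp: cdbm_le_iff_gamma)
next
  fix x assume "x \<in> carrier L"
  then show "x \<sqsubseteq>\<^bsub>L\<^esub> x" by (simp add: cdbm_le_iff_gamma)
qed (simp_all add: cdbm_order_def)

lemma gamma_subset_points: "x \<in> carrier L \<Longrightarrow> \<gamma> x \<subseteq> points I n"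
  by (elim carrier_cases) (auto simp: dbm_dom0_def)

text \<open>Entrywise maxima preserve the triangle inequality, so the join is closed as it stands
  and leastness is entrywise.\<close>

lemma cdbm_join_lub:
  assumes "x \<in> carrier L" "y \<in> carrier L"
  shows "is_lub L (cdbm_join n x y) {x, y}"
proof -
  have max: "dbm_max n m m' \<in> closed_dbms I n"
    if m: "m \<in> closed_dbms I n" "m' \<in> closed_dbms I n" for m m'
    unfolding closed_dbms_iff
  proof
    show "dbm_max n m m' \<in> dbms I n"
      unfolding dbm_max_def
      by (rule mk_dbm_in_dbms) (use m dbms_entry in \<open>auto simp: closed_dbms_iff max_def\<close>)
    show "dbm_triangle n (dbm_max n m m')"
      unfolding dbm_triangle_def
    proof (intro conjI ballI)
      fix i j k assume ijk: "i \<in> {1..n}" "j \<in> {1..n}" "k \<in> {1..n}"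
      have "m i j \<le> m i k + m k j" "m' i j \<le> m' i k + m' k j"
        using m ijk unfolding closed_dbms_iff dbm_triangle_def by blast+
      moreover have "m i k + m k j \<le> max (m i k) (m' i k) + max (m k j) (m' k j)"
        "m' i k + m' k j \<le> max (m i k) (m' i k) + max (m k j) (m' k j)"
        by (auto intro!: add_mono)
      ultimately show "dbm_max n m m' i j \<le> dbm_max n m m' i k + dbm_max n m m' k j"
        using ijk by (auto simp: dbm_max_def simp del: max_add_distrib_left max_add_distrib_right)
    next
      fix i assume "i \<in> {1..n}"
      then show "dbm_max n m m' i i = 0"
        using m by (auto simp: dbm_max_def closed_dbms_iff dbm_triangle_def)
    qed
  qed
  have refl: "dbm_le n m m" for m
    by (simp add: dbm_le_def)
  have ge: "dbm_le n m (dbm_max n m m')" "dbm_le n m' (dbm_max n m m')" for m m'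
    by (auto simp: dbm_le_def dbm_max_def)
  have least: "dbm_le n (dbm_max n m m') c" if "dbm_le n m c" "dbm_le n m' c" for m m' c
    using that by (auto simp: dbm_le_def dbm_max_def)
  have "cdbm_join n x y \<in> carrier L"
    using assms by (elim carrier_cases) (auto simp: max)
  moreover have "cdbm_le n x (cdbm_join n x y)" "cdbm_le n y (cdbm_join n x y)"
    using assms by (elim carrier_cases; simp add: refl ge)+
  moreover have "cdbm_le n (cdbm_join n x y) z" if "cdbm_le n x z" "cdbm_le n y z" for z
    using that by (cases x; cases y; cases z) (auto intro: least)
  ultimately show ?thesis
    using assms by (auto simp: least_def Upper_def cdbm_order_def)
qed

text \<open>As \<gamma> is an order embedding, an infimum can be recognised by its meaning. The
  factor \<open>points I n\<close> gives the right value for empty \<open>X\<close>.\<close>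

lemma cdbm_glbI:
  assumes "X \<subseteq> carrier L" "a \<in> carrier L" "\<gamma> a = points I n \<inter> (\<Inter>x\<in>X. \<gamma> x)"
  shows "is_glb L a X"
proof -
  have "a \<sqsubseteq>\<^bsub>L\<^esub> x" if "x \<in> X" for x
  proof -
    have "x \<in> carrier L" using assms(1) that by blast
    then show ?thesis using assms(2,3) that by (subst cdbm_le_iff_gamma) auto
  qed
  moreover have "b \<sqsubseteq>\<^bsub>L\<^esub> a" if b: "b \<in> carrier L" "\<forall>x\<in>X. b \<sqsubseteq>\<^bsub>L\<^esub> x" for b
  proof -
    have "\<gamma> b \<subseteq> \<gamma> x" if "x \<in> X" for x
      using b that assms(1) cdbm_le_iff_gamma[of b x] by blast
    then have "\<gamma> b \<subseteq> \<gamma> a"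
      using assms(3) gamma_subset_points[OF b(1)] by blast
    then show ?thesis using assms(2) b(1) by (simp add: cdbm_le_iff_gamma)
  qed
  ultimately show ?thesis
    using assms(1,2) unfolding greatest_def Lower_def by blast
qed

text \<open>The entrywise minimum has the intersection as its domain but may violate the triangle
  inequality; closing it keeps the domain, and an empty intersection is represented by
  \<open>None\<close>.\<close>

lemma cdbm_meet_glb:
  assumes "x \<in> carrier L" "y \<in> carrier L"
  shows "is_glb L (cdbm_meet I n x y) {x, y}"
proof -
  have min: "dbm_min n m m' \<in> dbms I n" if "m \<in> closed_dbms I n" "m' \<in> closed_dbms I n" for m m'
    unfolding dbm_min_def
    by (rule mk_dbm_in_dbms) (use that dbms_entry in \<open>auto simp: closed_dbms_iff min_def\<close>)
  have dom_min: "dbm_dom0 I n (dbm_min n m m') = dbm_dom0 I n m \<inter> dbm_dom0 I n m'" for m m'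
    unfolding dom0_iff set_eq_iff Int_iff potential_on_def
    by (auto simp: dbm_min_def simp del: fun_upd_apply)
  have "cdbm_meet I n x y \<in> carrier L \<and> \<gamma> (cdbm_meet I n x y) = \<gamma> x \<inter> \<gamma> y"
    using assms
    by (elim carrier_cases) (auto simp: closure_closed[OF min] dom_min)
  then show ?thesis
    using assms gamma_subset_points by (intro cdbm_glbI) auto
qed

lemma cdbm_top_greatest: "greatest L (cdbm_top n) (carrier L)"
proof -
  have "mk_dbm n (\<lambda>i j. if i = j then 0 else \<infinity>) \<in> closed_dbms I n"
    unfolding closed_dbms_iff
    using zero_ext_scalar
    by (auto simp: dbm_triangle_def ext_scalars_def intro!: mk_dbm_in_dbms)
  moreover have "dbm_le n m (mk_dbm n (\<lambda>i j. if i = j then 0 else \<infinity>))"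
    if "m \<in> closed_dbms I n" for m
    using that by (auto simp: closed_dbms_iff dbm_triangle_def dbm_le_def)
  ultimately show ?thesis
    by (auto simp: greatest_def cdbm_top_def cdbm_order_def)
qed

lemma cdbm_bot_least: "least L cdbm_bot (carrier L)"
  by (auto simp: least_def cdbm_bot_def cdbm_order_def)

lemma lattice_cdbm: "lattice L"
proof -
  interpret partial_order L by (rule partial_order_cdbm)
  show ?thesis
    by unfold_locales (use cdbm_join_lub cdbm_meet_glb in blast)+
qed

section \<open>Complete scalars\<close>

text \<open>
  For a non-empty set of points, the best matrix bounds each difference of coordinates by its
  supremum. The supremum is taken among the extended scalars: a least upper bound in \<open>I\<close>
  need not be one in the reals.
\<close>

definition dbm_hull :: "(nat \<Rightarrow> real) set \<Rightarrow> dbm" where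
  "dbm_hull D = mk_dbm n (\<lambda>i j. LEAST w. w \<in> ext_scalars I \<and>
     (\<forall>x\<in>D. ereal ((x(1 := 0)) j - (x(1 := 0)) i) \<le> w))"

lemma point_scalar:
  assumes "x \<in> points I n" "i \<in> {1..n}"
  shows "(x(1 := 0)) i \<in> I"
  using assms zero_scalar by (auto simp: points_def)

text \<open>Completeness enters here: differences bounded in \<open>I\<close> have a supremum in
  \<open>I\<close>.\<close>

lemma dbm_hull_lub:
  assumes compl: "complete_scalars I" and D: "D \<subseteq> points I n" "D \<noteq> {}"
    and ij: "i \<in> {1..n}" "j \<in> {1..n}"
  shows "dbm_hull D i j \<in> ext_scalars I"
    and "x \<in> D \<Longrightarrow> ereal ((x(1 := 0)) j - (x(1 := 0)) i) \<le> dbm_hull D i j"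
    and "w \<in> ext_scalars I \<Longrightarrow> (\<And>x. x \<in> D \<Longrightarrow> ereal ((x(1 := 0)) j - (x(1 := 0)) i) \<le> w)
           \<Longrightarrow> dbm_hull D i j \<le> w"
proof -
  define d where "d x = (x(1 := 0)) j - (x(1 := 0)) i" for x :: "nat \<Rightarrow> real"
  define P where "P w \<longleftrightarrow> w \<in> ext_scalars I \<and> (\<forall>x\<in>D. ereal (d x) \<le> w)" for w
  have "\<exists>w. P w \<and> (\<forall>w'. P w' \<longrightarrow> w \<le> w')"
  proof (cases "\<exists>b\<in>I. \<forall>x\<in>D. d x \<le> b")
    case True
    have "d ` D \<subseteq> I"
      using D(1) point_scalar ij unfolding d_def by (blast intro: diff_scalar)
    then obtain l where l: "l \<in> I" "\<forall>s\<in>d ` D. s \<le> l"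
      "\<forall>b\<in>I. (\<forall>s\<in>d ` D. s \<le> b) \<longrightarrow> l \<le> b"
      using compl[unfolded complete_scalars_def, rule_format, of "d ` D"] True D(2) by auto
    have "P (ereal l)" using l by (auto simp: P_def ext_scalars_def)
    moreover have "ereal l \<le> w'" if "P w'" for w'
      using that l(3) by (auto simp: P_def ext_scalars_def)
    ultimately show ?thesis by blast
  next
    case False
    \<comment> \<open>Without a bound in \<open>I\<close>, \<infinity> is the only extended scalar
      above all differences.\<close>
    then show ?thesis
      by (intro exI[of _ \<infinity>]) (auto simp: P_def ext_scalars_def)
  qed
  then obtain w where w: "P w" "\<And>w'. P w' \<Longrightarrow> w \<le> w'" by blast
  have "dbm_hull D i j = (LEAST w. P w)"
    using ij by (simp add: dbm_hull_def P_def d_def del: fun_upd_apply)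
  also have "\<dots> = w"
    by (rule Least_equality) (use w in auto)
  finally have eq: "dbm_hull D i j = w" .
  show "dbm_hull D i j \<in> ext_scalars I"
    "x \<in> D \<Longrightarrow> ereal ((x(1 := 0)) j - (x(1 := 0)) i) \<le> dbm_hull D i j"
    using w(1) unfolding eq P_def d_def by blast+
  show "w' \<in> ext_scalars I \<Longrightarrow> (\<And>x. x \<in> D \<Longrightarrow> ereal ((x(1 := 0)) j - (x(1 := 0)) i) \<le> w')
          \<Longrightarrow> dbm_hull D i j \<le> w'" for w'
    unfolding eq by (rule w(2)) (auto simp: P_def d_def simp del: fun_upd_apply)
qed

text \<open>Each difference splits through \<open>k\<close> into two differences, each below its own
  supremum.\<close>

lemma dbm_hull_closed:
  assumes compl: "complete_scalars I" and D: "D \<subseteq> points I n" "D \<noteq> {}"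
  shows "dbm_hull D \<in> closed_dbms I n"
  unfolding closed_dbms_iff
proof
  note hull = dbm_hull_lub[OF compl D]
  show "dbm_hull D \<in> dbms I n"
    using hull(1) unfolding dbm_hull_def by (intro mk_dbm_in_dbms) simp
  show "dbm_triangle n (dbm_hull D)"
    unfolding dbm_triangle_def
  proof (intro conjI ballI)
    fix i assume i: "i \<in> {1..n}"
    obtain x where "x \<in> D" using D(2) by blast
    have "dbm_hull D i i \<le> 0"
      by (rule hull(3)[OF i i]) (auto simp: zero_ext_scalar)
    moreover have "0 \<le> dbm_hull D i i"
      using hull(2)[OF i i \<open>x \<in> D\<close>] by (simp add: zero_ereal_def)
    ultimately show "dbm_hull D i i = 0" by (rule antisym)
  next
    fix i j k assume ijk: "i \<in> {1..n}" "j \<in> {1..n}" "k \<in> {1..n}"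
    show "dbm_hull D i j \<le> dbm_hull D i k + dbm_hull D k j"
    proof (rule hull(3)[OF ijk(1,2)])
      show "dbm_hull D i k + dbm_hull D k j \<in> ext_scalars I"
        using hull(1) ijk by (intro ext_scalars_add) auto
      fix x assume x: "x \<in> D"
      let ?y = "x(1 := 0)"
      have "ereal (?y k - ?y i) + ereal (?y j - ?y k) \<le> dbm_hull D i k + dbm_hull D k j"
        using hull(2)[OF ijk(1,3) x] hull(2)[OF ijk(3,2) x] by (rule add_mono)
      then show "ereal (?y j - ?y i) \<le> dbm_hull D i k + dbm_hull D k j" 
        by (simp del: fun_upd_apply)
    qed
  qed
qed

text \<open>The hull is the least closed matrix whose domain contains \<open>D\<close>; this is the
  Galois adjunction for non-empty sets.\<close>

lemma dbm_hull_dom0_iff: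
  assumes compl: "complete_scalars I" and D: "D \<subseteq> points I n" "D \<noteq> {}"
    and m: "m \<in> closed_dbms I n"
  shows "dbm_le n (dbm_hull D) m \<longleftrightarrow> D \<subseteq> dbm_dom0 I n m"
proof
  note hull = dbm_hull_lub[OF compl D]
  have "D \<subseteq> dbm_dom0 I n (dbm_hull D)"
    using hull(2) D(1) point_scalar unfolding subset_iff dom0_iff potential_on_def by blast
  then show "D \<subseteq> dbm_dom0 I n m" if "dbm_le n (dbm_hull D) m"
    using dom0_mono[OF that] by blast
  show "dbm_le n (dbm_hull D) m" if "D \<subseteq> dbm_dom0 I n m"
    unfolding dbm_le_def
  proof (intro ballI)
    fix i j assume ij: "i \<in> {1..n}" "j \<in> {1..n}"
    show "dbm_hull D i j \<le> m i j"
    proof (rule hull(3)[OF ij])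
      show "m i j \<in> ext_scalars I"
        using m dbms_entry ij by (simp add: closed_dbms_iff)
      fix x assume "x \<in> D"
      then show "ereal ((x(1 := 0)) j - (x(1 := 0)) i) \<le> m i j"
        using that ij unfolding dom0_iff potential_on_def subset_iff by blast
    qed
  qed
qed

text \<open>Over the empty set no least extended scalar exists, so its best abstraction is the added
  bottom.\<close>

definition cdbm_hull :: "(nat \<Rightarrow> real) set \<Rightarrow> dbm option" where
  "cdbm_hull D = (if D = {} then None else Some (dbm_hull D))"

lemma cdbm_hull_carrier:
  "complete_scalars I \<Longrightarrow> D \<subseteq> points I n \<Longrightarrow> cdbm_hull D \<in> carrier L"
  by (simp add: cdbm_hull_def dbm_hull_closed)

lemma cdbm_hull_le_iff:
  assumes "complete_scalars I" "D \<subseteq> points I n" "x \<in> carrier L"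
  shows "cdbm_hull D \<sqsubseteq>\<^bsub>L\<^esub> x \<longleftrightarrow> D \<subseteq> \<gamma> x"
  using assms(3)
  by (elim carrier_cases) (auto simp: cdbm_hull_def cdbm_order_def dbm_hull_dom0_iff[OF assms(1,2)])

text \<open>Intersections of meanings are exactly representable: the hull of \<open>D\<close> lies
  below each \<open>x\<close> in \<open>X\<close>, so its meaning cannot leave the
  intersection.\<close>

lemma gamma_hull_Inter:
  assumes compl: "complete_scalars I" and X: "X \<subseteq> carrier L"
    and D: "D = points I n \<inter> (\<Inter>x\<in>X. \<gamma> x)"
  shows "\<gamma> (cdbm_hull D) = D"
proof
  have hull: "cdbm_hull D \<in> carrier L"
    and le: "x \<in> carrier L \<Longrightarrow> \<gamma> (cdbm_hull D) \<subseteq> \<gamma> x \<longleftrightarrow> D \<subseteq> \<gamma> x" for x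
    using compl D cdbm_hull_carrier[of D] cdbm_hull_le_iff[of D] cdbm_le_iff_gamma by auto
  show "D \<subseteq> \<gamma> (cdbm_hull D)" using hull le by blast
  have "\<gamma> (cdbm_hull D) \<subseteq> \<gamma> x" if "x \<in> X" for x
    using that le X D by blast
  then show "\<gamma> (cdbm_hull D) \<subseteq> D"
    using gamma_subset_points[OF hull] D by blast
qed

lemma is_glb_hull:
  assumes compl: "complete_scalars I" and X: "X \<subseteq> carrier L"
  shows "is_glb L (cdbm_hull (points I n \<inter> (\<Inter>x\<in>X. \<gamma> x))) X"
  by (rule cdbm_glbI[OF X cdbm_hull_carrier[OF compl Int_lower1] gamma_hull_Inter[OF compl X refl]])

section \<open>Arbitrary infima, abstraction and the Galois insertion\<close>

lemma complete_lattice_cdbm: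
  assumes "complete_scalars I"
  shows "complete_lattice L"
proof -
  interpret partial_order L by (rule partial_order_cdbm)
  show ?thesis
  proof (rule complete_lattice_criterion1)
    show "\<exists>g. greatest L g (carrier L)" using cdbm_top_greatest ..
    fix X assume X: "X \<subseteq> carrier L"
    show "\<exists>a. is_glb L a X"
      using is_glb_hull[OF assms X] ..
  qed
qed

text \<open>The infimum operator is a Hilbert choice, so its value is identified through uniqueness
  of greatest lower bounds.\<close>

lemma inf_eqI:
  assumes "is_glb L a X"
  shows "\<Sqinter>\<^bsub>L\<^esub> X = a"
proof -
  interpret partial_order L by (rule partial_order_cdbm)
  show ?thesis
    unfolding inf_def
    by (rule some_equality) (use assms greatest_unique in blast)+
qed

lemma inf_eq_hull:
  assumes compl: "complete_scalars I" and X: "X \<subseteq> carrier L"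
  shows "\<Sqinter>\<^bsub>L\<^esub> X = cdbm_hull (points I n \<inter> (\<Inter>x\<in>X. \<gamma> x))"
  by (rule inf_eqI[OF is_glb_hull[OF compl X]])

lemma gamma_inf:
  assumes "complete_scalars I" "X \<subseteq> carrier L"
  shows "\<gamma> (\<Sqinter>\<^bsub>L\<^esub> X) = points I n \<inter> (\<Inter>x\<in>X. \<gamma> x)"
  using gamma_hull_Inter[OF assms] inf_eq_hull[OF assms] by simp

text \<open>By \<open>cdbm_hull_le_iff\<close> the hull is itself the least member of the set whose
  infimum defines the abstraction.\<close>

lemma alpha_eq_hull:
  assumes compl: "complete_scalars I" and D: "D \<subseteq> points I n"
  shows "cdbm_alpha I n D = cdbm_hull D"
proof -
  interpret partial_order L by (rule partial_order_cdbm)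
  let ?X = "{x \<in> carrier L. D \<subseteq> \<gamma> x}"
  have hull: "cdbm_hull D \<in> carrier L"
    by (rule cdbm_hull_carrier[OF compl D])
  then have "D \<subseteq> \<gamma> (cdbm_hull D)"
    using cdbm_hull_le_iff[OF compl D hull] le_refl by blast
  then have "is_glb L (cdbm_hull D) ?X"
    using hull cdbm_hull_le_iff[OF compl D]
    by (auto simp: greatest_def Lower_def)
  then show ?thesis
    unfolding cdbm_alpha_def by (rule inf_eqI)
qed

lemma galois_insertion_cdbm:
  assumes compl: "complete_scalars I"
  shows "galois_insertion
    \<lparr>orderA = powerset_order (points I n), orderB = L, lower = cdbm_alpha I n, upper = \<gamma>\<rparr>"
    (is "galois_insertion ?G")
proof -
  have "partial_order (powerset_order (points I n))"
    by unfold_locales (auto simp: powerset_order_def)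
  then have "galois_connection ?G"
    using partial_order_cdbm gamma_subset_points
    unfolding galois_connection_def connection_def galois_connection_axioms_def
    by (auto simp: powerset_order_def alpha_eq_hull[OF compl] cdbm_hull_carrier[OF compl] cdbm_hull_le_iff[OF compl])
  moreover have "cdbm_alpha I n (\<gamma> x) = x" if x: "x \<in> carrier L" for x
  \<comment> \<open>Injectivity of \<gamma> reduces the claim to equal meanings, which is
    \<open>gamma_hull_Inter\<close> for the singleton \<open>{x}\<close>.\<close>
  proof (rule inj_onD[OF gamma_inj _ _ x])
    have sub: "\<gamma> x \<subseteq> points I n" by (rule gamma_subset_points[OF x])
    then show "cdbm_alpha I n (\<gamma> x) \<in> carrier L"
      by (simp add: alpha_eq_hull[OF compl] cdbm_hull_carrier[OF compl])
    have "\<gamma> (cdbm_hull (\<gamma> x)) = \<gamma> x"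
      using x sub by (intro gamma_hull_Inter[OF compl, of "{x}"]) auto
    then show "\<gamma> (cdbm_alpha I n (\<gamma> x)) = \<gamma> x"
      using sub by (simp add: alpha_eq_hull[OF compl])
  qed
  ultimately show ?thesis by (simp add: galois_insertion_def)
qed

end

section \<open>Which of the three scalar sets are complete\<close>

lemma complete_scalars_UNIV: "complete_scalars UNIV"
  unfolding complete_scalars_def
proof (intro allI impI)
  fix S :: "real set" assume "S \<noteq> {} \<and> (\<exists>b\<in>UNIV. \<forall>s\<in>S. s \<le> b)"
  then show "\<exists>l\<in>UNIV. (\<forall>s\<in>S. s \<le> l) \<and> (\<forall>b\<in>UNIV. (\<forall>s\<in>S. s \<le> b) \<longrightarrow> l \<le> b)"
    by (intro bexI[of _ "Sup S"]) (auto intro!: cSup_upper cSup_least bdd_aboveI)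
qed

text \<open>A bounded non-empty set of integers has a maximum: above any chosen member only finitely
  many elements remain.\<close>

lemma complete_scalars_Ints: "complete_scalars \<int>"
  unfolding complete_scalars_def
proof (intro allI impI)
  fix S :: "real set" assume S: "S \<subseteq> \<int>" and "S \<noteq> {} \<and> (\<exists>b\<in>\<int>. \<forall>s\<in>S. s \<le> b)"
  then obtain s b where s: "s \<in> S" and b: "\<And>s. s \<in> S \<Longrightarrow> s \<le> b" by blast
  let ?T = "S \<inter> {s..b}"
  have fin: "finite ?T"
    by (rule finite_subset[OF _ finite_abs_int_segment[of "max \<bar>s\<bar> \<bar>b\<bar>"]]) (use S in auto)
  moreover have sT: "s \<in> ?T" using s b by simp
  ultimately have max: "Max ?T \<in> ?T"
    by (metis Max_in empty_iff)
  have "t \<le> Max ?T" if "t \<in> S" for t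
    using Max_ge[OF fin, of t] Max_ge[OF fin sT] b that by (cases "s \<le> t") auto
  moreover have "Max ?T \<in> S" using max by blast
  ultimately show "\<exists>l\<in>\<int>. (\<forall>s\<in>S. s \<le> l) \<and> (\<forall>b\<in>\<int>. (\<forall>s\<in>S. s \<le> b) \<longrightarrow> l \<le> b)"
    using S by blast
qed

text \<open>The rationals below an irrational \<open>c\<close> have no rational supremum: density
  refutes candidates on either side of \<open>c\<close>.\<close>

lemma not_complete_scalars_Rats: "\<not> complete_scalars \<rat>"
proof
  assume compl: "complete_scalars \<rat>"
  \<comment> \<open>An irrational exists because the reals are uncountable and the rationals are
    not.\<close>
  obtain c :: real where c: "c \<notin> \<rat>"
    using countable_rat uncountable_UNIV_real by (metis UNIV_eq_I)
  let ?S = "{q \<in> \<rat>. q < c}"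
  obtain q where "q \<in> ?S"
    using Rats_dense_in_real[of "c - 1" c] by auto
  moreover obtain b where "b \<in> \<rat>" "c < b"
    using Rats_dense_in_real[of c "c + 1"] by auto
  ultimately obtain l where l: "l \<in> \<rat>" "\<forall>s\<in>?S. s \<le> l" "\<forall>b\<in>\<rat>. (\<forall>s\<in>?S. s \<le> b) \<longrightarrow> l \<le> b"
    using compl[unfolded complete_scalars_def, rule_format, of ?S] by force
  consider "l < c" | "c < l" using c l(1) by fastforce
  then show False
  proof cases
    case 1
    then obtain r where "r \<in> \<rat>" "l < r" "r < c" using Rats_dense_in_real by blast
    then show False using l(2) by fastforce
  next
    case 2
    then obtain r where "r \<in> \<rat>" "c < r" "r < l" using Rats_dense_in_real by blast
    then show False using l(3) by fastforce
  qed
qed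

theorem theorem16:
  fixes I :: "real set" and n :: nat
  assumes "I \<in> {\<int>, \<rat>, UNIV}" and "n \<ge> 1"
  shows
    "(lattice (cdbm_order I n) \<and>
      (\<forall>x\<in>carrier (cdbm_order I n). \<forall>y\<in>carrier (cdbm_order I n).
         is_lub (cdbm_order I n) (cdbm_join n x y) {x, y} \<and>
         is_glb (cdbm_order I n) (cdbm_meet I n x y) {x, y}) \<and>
      least (cdbm_order I n) cdbm_bot (carrier (cdbm_order I n)) \<and>
      greatest (cdbm_order I n) (cdbm_top n) (carrier (cdbm_order I n)) \<and>
      inj_on (cdbm_gamma I n) (carrier (cdbm_order I n)))
     \<and>
     (complete_scalars I \<longleftrightarrow> I = \<int> \<or> I = UNIV)
     \<and>
     (complete_scalars I \<longrightarrow>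
        complete_lattice (cdbm_order I n) \<and>
        \<comment> \<open>the intersection is taken inside \<open>points I n\<close>, which matters for \<open>X = {}\<close>\<close>
        (\<forall>X\<subseteq>carrier (cdbm_order I n).
           cdbm_gamma I n (\<Sqinter>\<^bsub>cdbm_order I n\<^esub> X) = points I n \<inter> (\<Inter>x\<in>X. cdbm_gamma I n x)) \<and>
        galois_insertion
          \<lparr>orderA = powerset_order (points I n), orderB = cdbm_order I n,
           lower = cdbm_alpha I n, upper = cdbm_gamma I n\<rparr>)"
proof -
  interpret dbm_space I n
    by unfold_locales (use assms in auto)
  have "complete_scalars I \<longleftrightarrow> I = \<int> \<or> I = UNIV"
    using assms(1) complete_scalars_Ints complete_scalars_UNIV not_complete_scalars_Rats by auto
  then show ?thesis
    by (intro conjI ballI impI allI lattice_cdbm cdbm_join_lub cdbm_meet_glb cdbm_bot_least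
        cdbm_top_greatest gamma_inj complete_lattice_cdbm gamma_inf galois_insertion_cdbm)
qed

end
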